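(* Let $X$ be a quasi-projective variety defined over a field $K$, let $\Phi:X\longrightarrow X$ be an endomorphism defined over $K$, let $C\subseteq X$ be an irreducible curve, and let $\alpha\in X(K)$ be a point that is not preperiodic under $\Phi$. If the set $S:=\{n\in\mathbb{N}\colon \Phi^n(\alpha)\in C(K)\}$ has Banach density $\delta>0$, then $S$ contains an infinite arithmetic progression of ratio $k=\frac{1}{\delta}$, and $\Phi^k(C)\subseteq C$.
   Context: $\Phi^n$ denotes the $n$-th iterate of $\Phi$. A point $\alpha$ is preperiodic under $\Phi$ if its orbit $\{\Phi^n(\alpha)\colon n\ge 0\}$ is finite. For $S\subseteq\mathbb{N}$, the Banach density is $\delta(S):=\limsup_{|I|\to\infty}\frac{|S\cap I|}{|I|}$, the $\limsup$ taken over intervals $I$ of natural numbers. An infinite arithmetic progression of ratio $k\ge 1$ is a set $\{kn+b\colon n\ge 0\}$ with $b\in\mathbb{N}$. *)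

theory Defs
  imports
    "HOL-Algebra.Algebraic_Closure_Type"
    "HOL-Analysis.Analysis"
    "HOL-Library.Poly_Mapping"
begin

section \<open>Projective space\<close>

text \<open>
  The coordinates are indexed by a finite type \<open>'n\<close>, so that \<open>('n, 'a) proj\<close> is projective
  space of dimension \<open>CARD('n) - 1\<close> over \<open>'a\<close>. A point is represented by the set of all its
  homogeneous coordinate vectors, i.e. by a line without the origin.
\<close>

typedef (overloaded) ('n, 'a :: field) proj =
  "{l :: ('n \<Rightarrow> 'a) set. \<exists>v. v \<noteq> (\<lambda>_. 0) \<and> l = {w. \<exists>c. c \<noteq> 0 \<and> w = (\<lambda>i. c * v i)}}"
  morphisms hcoords Abs_proj
  by (rule exI[of _ "{w. \<exists>c. c \<noteq> 0 \<and> w = (\<lambda>i. c * (\<lambda>_. 1) i)}"])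
     (auto intro!: exI[of _ "\<lambda>_. 1"] simp: fun_eq_iff)

lemma hcoords_nonempty: "hcoords P \<noteq> {}"
proof -
  obtain v where v: "v \<noteq> (\<lambda>_. 0)" "hcoords P = {w. \<exists>c. c \<noteq> 0 \<and> w = (\<lambda>i. c * v i)}"
    using hcoords[of P] by auto
  have "v \<in> hcoords P" unfolding v(2) by (auto intro!: exI[of _ 1])
  then show ?thesis by blast
qed

lemma hcoords_nonzero: "v \<in> hcoords P \<Longrightarrow> v \<noteq> (\<lambda>_. 0)"
  using hcoords[of P] by (fastforce simp: fun_eq_iff)

lemma hcoords_eq:
  assumes "x \<in> hcoords P"
  shows "hcoords P = {w. \<exists>c. c \<noteq> 0 \<and> w = (\<lambda>i. c * x i)}"
proof -
  obtain v where v: "hcoords P = {w. \<exists>c. c \<noteq> 0 \<and> w = (\<lambda>i. c * v i)}"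
    using hcoords[of P] by auto
  with assms obtain a where a: "a \<noteq> 0" "x = (\<lambda>i. a * v i)" by auto
  have "(\<exists>c. c \<noteq> 0 \<and> w = (\<lambda>i. c * v i)) \<longleftrightarrow> (\<exists>c. c \<noteq> 0 \<and> w = (\<lambda>i. c * x i))" for w
  proof
    assume "\<exists>c. c \<noteq> 0 \<and> w = (\<lambda>i. c * v i)"
    then obtain c where "c \<noteq> 0" "w = (\<lambda>i. c * v i)" by blast
    with a show "\<exists>c. c \<noteq> 0 \<and> w = (\<lambda>i. c * x i)"
      by (intro exI[of _ "c / a"]) (auto simp: fun_eq_iff)
  next
    assume "\<exists>c. c \<noteq> 0 \<and> w = (\<lambda>i. c * x i)"
    then obtain c where "c \<noteq> 0" "w = (\<lambda>i. c * x i)" by blast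
    with a show "\<exists>c. c \<noteq> 0 \<and> w = (\<lambda>i. c * v i)"
      by (intro exI[of _ "c * a"]) (auto simp: fun_eq_iff)
  qed
  with v show ?thesis by simp
qed


section \<open>Homogeneous polynomials\<close>

type_synonym ('n, 'k) mpoly = "('n \<Rightarrow>\<^sub>0 nat) \<Rightarrow>\<^sub>0 'k"

definition monom_degree :: "('n :: finite \<Rightarrow>\<^sub>0 nat) \<Rightarrow> nat" where
  "monom_degree m = (\<Sum>i\<in>UNIV. Poly_Mapping.lookup m i)"

definition homogeneous :: "nat \<Rightarrow> ('n :: finite, 'k :: zero) mpoly \<Rightarrow> bool" where
  "homogeneous d f \<longleftrightarrow> (\<forall>m\<in>Poly_Mapping.keys f. monom_degree m = d)"

definition monom_eval :: "('n :: finite \<Rightarrow>\<^sub>0 nat) \<Rightarrow> ('n \<Rightarrow> 'a :: comm_semiring_1) \<Rightarrow> 'a" where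
  "monom_eval m x = (\<Prod>i\<in>UNIV. x i ^ Poly_Mapping.lookup m i)"

text \<open>Polynomials have coefficients in \<open>'k\<close> but are evaluated at vectors over its algebraic closure.\<close>

definition eval_ac :: "('n :: finite, 'k :: field) mpoly \<Rightarrow> ('n \<Rightarrow> 'k alg_closure) \<Rightarrow> 'k alg_closure" where
  "eval_ac f x = (\<Sum>m\<in>Poly_Mapping.keys f. to_ac (Poly_Mapping.lookup f m) * monom_eval m x)"

lemma eval_ac_superset:
  assumes "finite A" "Poly_Mapping.keys f \<subseteq> A"
  shows "eval_ac f x = (\<Sum>m\<in>A. to_ac (Poly_Mapping.lookup f m) * monom_eval m x)"
  unfolding eval_ac_def
  by (rule sum.mono_neutral_left) (use assms in \<open>auto simp: in_keys_iff\<close>)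

lemma eval_ac_add: "eval_ac (f + g) x = eval_ac f x + eval_ac g x"
proof -
  let ?A = "Poly_Mapping.keys f \<union> Poly_Mapping.keys g"
  have *: "finite ?A" "Poly_Mapping.keys f \<subseteq> ?A" "Poly_Mapping.keys g \<subseteq> ?A"
    "Poly_Mapping.keys (f + g) \<subseteq> ?A"
    using Poly_Mapping.keys_add[of f g] by auto
  show ?thesis
    using *(2-)[THEN eval_ac_superset[OF *(1)]]
    by (simp add: lookup_add sum.distrib algebra_simps)
qed

lemma eval_ac_0 [simp]: "eval_ac 0 x = 0"
  by (simp add: eval_ac_def)

lemma eval_ac_sum: "eval_ac (\<Sum>i\<in>I. f i) x = (\<Sum>i\<in>I. eval_ac (f i) x)"
  by (induction I rule: infinite_finite_induct) (auto simp: eval_ac_add)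

lemma eval_ac_single: "eval_ac (Poly_Mapping.single m c) x = to_ac c * monom_eval m x"
proof -
  have "eval_ac (Poly_Mapping.single m c) x =
      (\<Sum>k\<in>{m}. to_ac (Poly_Mapping.lookup (Poly_Mapping.single m c) k) * monom_eval k x)"
    by (rule eval_ac_superset) auto
  then show ?thesis by (simp only: sum.insert sum.empty finite.emptyI empty_iff not_False_eq_True
      lookup_single_eq add_0_right)
qed

lemma monom_eval_add: "monom_eval (a + b) x = monom_eval a x * monom_eval b x"
  by (simp add: monom_eval_def lookup_add power_add prod.distrib)

lemma monom_degree_add: "monom_degree (a + b) = monom_degree a + monom_degree b"
  by (simp add: monom_degree_def lookup_add sum.distrib)

lemma mpoly_sum_single:
  "f = (\<Sum>m\<in>Poly_Mapping.keys f. Poly_Mapping.single m (Poly_Mapping.lookup f m))"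
  by (rule poly_mapping_eqI)
     (auto simp: lookup_sum lookup_single when_def in_keys_iff)

lemma eval_ac_mult: "eval_ac (f * g) x = eval_ac f x * eval_ac g x"
proof -
  let ?s = "\<lambda>f m. Poly_Mapping.single m (Poly_Mapping.lookup f m)"
  have "f * g = (\<Sum>a\<in>Poly_Mapping.keys f. ?s f a) * (\<Sum>b\<in>Poly_Mapping.keys g. ?s g b)"
    by (intro arg_cong2[where f = "(*)"] mpoly_sum_single)
  also have "\<dots> = (\<Sum>a\<in>Poly_Mapping.keys f. \<Sum>b\<in>Poly_Mapping.keys g. ?s f a * ?s g b)"
    by (simp add: sum_product)
  finally have "eval_ac (f * g) x =
      (\<Sum>a\<in>Poly_Mapping.keys f. \<Sum>b\<in>Poly_Mapping.keys g.
         (to_ac (Poly_Mapping.lookup f a) * monom_eval a x) *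
         (to_ac (Poly_Mapping.lookup g b) * monom_eval b x))"
    by (simp only: eval_ac_sum mult_single eval_ac_single monom_eval_add to_ac_mult mult_ac)
  also have "\<dots> = eval_ac f x * eval_ac g x"
    by (simp add: eval_ac_def sum_product)
  finally show ?thesis .
qed

lemma homogeneous_mult: "homogeneous d f \<Longrightarrow> homogeneous e g \<Longrightarrow> homogeneous (d + e) (f * g)"
  unfolding homogeneous_def
  using keys_mult[of f g] by (fastforce simp: monom_degree_add)

lemma monom_eval_scale: "monom_eval m (\<lambda>i. c * x i) = c ^ monom_degree m * monom_eval m x"
  by (simp only: monom_eval_def monom_degree_def power_mult_distrib prod.distrib power_sum)

lemma eval_ac_scale:
  assumes "homogeneous d f"
  shows "eval_ac f (\<lambda>i. c * x i) = c ^ d * eval_ac f x"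
  unfolding eval_ac_def sum_distrib_left
proof (rule sum.cong [OF refl])
  fix m assume "m \<in> Poly_Mapping.keys f"
  with assms have "monom_degree m = d" by (simp only: homogeneous_def)
  then show "to_ac (Poly_Mapping.lookup f m) * monom_eval m (\<lambda>i. c * x i) =
      c ^ d * (to_ac (Poly_Mapping.lookup f m) * monom_eval m x)"
    by (simp only: monom_eval_scale mult.left_commute)
qed


section \<open>The Zariski topology over the ground field\<close>

text \<open>
  The ground field is \<open>'k\<close>, and the geometric points of projective space are those with
  coordinates in the algebraic closure of \<open>'k\<close>. Only zero loci of polynomials with coefficients
  in \<open>'k\<close> are closed, so that closed sets are the closed subvarieties defined over \<open>'k\<close>, and
  irreducibility of a set is irreducibility over \<open>'k\<close>.
\<close>

definition zero_locus :: "('n :: finite, 'k :: field) mpoly set \<Rightarrow> ('n, 'k alg_closure) proj set" where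
  "zero_locus F = {P. \<forall>f\<in>F. \<forall>x\<in>hcoords P. eval_ac f x = 0}"

definition projective_algebraic :: "('n :: finite, 'k :: field alg_closure) proj set \<Rightarrow> bool" where
  "projective_algebraic Z \<longleftrightarrow>
     (\<exists>F :: ('n, 'k) mpoly set. (\<forall>f\<in>F. \<exists>d. homogeneous d f) \<and> Z = zero_locus F)"

definition zariski :: "('n :: finite, 'k :: field alg_closure) proj topology" where
  "zariski = topology (\<lambda>U. projective_algebraic (- U))"

lemma projective_algebraic_Un:
  assumes "projective_algebraic A" "projective_algebraic B"
  shows "projective_algebraic (A \<union> B)"
proof -
  obtain F G where F: "\<forall>f\<in>F. \<exists>d. homogeneous d f" "A = zero_locus F"
    and G: "\<forall>g\<in>G. \<exists>d. homogeneous d g" "B = zero_locus G"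
    using assms unfolding projective_algebraic_def by blast
  let ?H = "{f * g | f g. f \<in> F \<and> g \<in> G}"
  have "zero_locus ?H = A \<union> B"
  proof (intro equalityI subsetI)
    fix P assume P: "P \<in> zero_locus ?H"
    show "P \<in> A \<union> B"
    proof (rule ccontr)
      assume "P \<notin> A \<union> B"
      then obtain f g x y where *: "f \<in> F" "g \<in> G" "x \<in> hcoords P" "y \<in> hcoords P"
        "eval_ac f x \<noteq> 0" "eval_ac g y \<noteq> 0"
        unfolding F(2) G(2) zero_locus_def by blast
      obtain d where d: "homogeneous d f" using F(1) *(1) by blast
      from *(4) have "y \<in> {w. \<exists>c. c \<noteq> 0 \<and> w = (\<lambda>i. c * x i)}"
        by (simp only: hcoords_eq[OF *(3)])
      then obtain c where c: "c \<noteq> 0" "y = (\<lambda>i. c * x i)" by blast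
      have "eval_ac f y = c ^ d * eval_ac f x" unfolding c(2) by (rule eval_ac_scale[OF d])
      with c(1) *(5) have "eval_ac f y \<noteq> 0" by (simp only: mult_eq_0_iff power_eq_0_iff simp_thms)
      with *(6) have "eval_ac (f * g) y \<noteq> 0" by (simp only: eval_ac_mult mult_eq_0_iff simp_thms)
      moreover have "f * g \<in> ?H" using *(1,2) by blast
      ultimately show False using P *(4) unfolding zero_locus_def by blast
    qed
  next
    fix P assume "P \<in> A \<union> B"
    then consider "\<forall>f\<in>F. \<forall>x\<in>hcoords P. eval_ac f x = 0" | "\<forall>g\<in>G. \<forall>x\<in>hcoords P. eval_ac g x = 0"
      unfolding F(2) G(2) zero_locus_def by blast
    then show "P \<in> zero_locus ?H"
    proof cases
      case 1
      then have "eval_ac (f * g) x = 0" if "f \<in> F" "x \<in> hcoords P" for f g x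
        using that by (simp only: eval_ac_mult mult_zero_left)
      then show ?thesis unfolding zero_locus_def by blast
    next
      case 2
      then have "eval_ac (f * g) x = 0" if "g \<in> G" "x \<in> hcoords P" for f g x
        using that by (simp only: eval_ac_mult mult_zero_right)
      then show ?thesis unfolding zero_locus_def by blast
    qed
  qed
  moreover have "\<forall>h\<in>?H. \<exists>d. homogeneous d h"
    using F(1) G(1) homogeneous_mult by blast
  ultimately show ?thesis unfolding projective_algebraic_def by (intro exI[of _ ?H] conjI) simp_all
qed

lemma projective_algebraic_INT:
  assumes "\<forall>Z\<in>\<Z>. projective_algebraic Z"
  shows "projective_algebraic (\<Inter>\<Z>)"
proof -
  from assms have "\<forall>Z\<in>\<Z>. \<exists>F. (\<forall>f\<in>F. \<exists>d. homogeneous d f) \<and> Z = zero_locus F"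
    unfolding projective_algebraic_def .
  from bchoice[OF this] obtain F
    where hom: "\<forall>Z\<in>\<Z>. \<forall>f\<in>F Z. \<exists>d. homogeneous d f" and F: "\<forall>Z\<in>\<Z>. Z = zero_locus (F Z)"
    by blast
  have "\<Inter>\<Z> = (\<Inter>Z\<in>\<Z>. zero_locus (F Z))"
    using INF_cong[of \<Z> \<Z> "\<lambda>Z. Z" "\<lambda>Z. zero_locus (F Z)"] F by simp
  also have "\<dots> = zero_locus (\<Union>Z\<in>\<Z>. F Z)" unfolding zero_locus_def by blast
  finally show ?thesis unfolding projective_algebraic_def
    by (intro exI[of _ "\<Union>Z\<in>\<Z>. F Z"] conjI) (use hom in blast)
qed

lemma istopology_zariski: "istopology (\<lambda>U. projective_algebraic (- U))"
  unfolding istopology_def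
proof (intro conjI allI impI)
  fix S T :: "('n :: finite, 'k :: field alg_closure) proj set"
  assume "projective_algebraic (- S)" "projective_algebraic (- T)"
  then show "projective_algebraic (- (S \<inter> T))"
    using projective_algebraic_Un by (simp add: Compl_Int)
next
  fix \<K> :: "('n :: finite, 'k :: field alg_closure) proj set set"
  assume "\<forall>K\<in>\<K>. projective_algebraic (- K)"
  then have "projective_algebraic (\<Inter>(uminus ` \<K>))"
    by (intro projective_algebraic_INT) auto
  then show "projective_algebraic (- \<Union>\<K>)"
    by (simp only: uminus_Sup)
qed

lemma openin_zariski: "openin zariski U \<longleftrightarrow> projective_algebraic (- U)"
  unfolding zariski_def topology_inverse'[OF istopology_zariski] ..

lemma topspace_zariski [simp]:
  "topspace (zariski :: ('n :: finite, 'k :: field alg_closure) proj topology) = UNIV"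
proof -
  have "zero_locus {Poly_Mapping.single 0 1 :: ('n, 'k) mpoly} = {}"
  proof -
    have "eval_ac (Poly_Mapping.single 0 1 :: ('n, 'k) mpoly) x = 1" for x
      by (simp only: eval_ac_single monom_eval_def lookup_zero power_0 prod.neutral_const to_ac_1
          mult_1_left)
    then show ?thesis unfolding zero_locus_def by (auto simp: hcoords_nonempty)
  qed
  moreover have "homogeneous 0 (Poly_Mapping.single 0 1 :: ('n, 'k) mpoly)"
    by (simp add: homogeneous_def monom_degree_def)
  ultimately have "projective_algebraic ({} :: ('n, 'k alg_closure) proj set)"
    unfolding projective_algebraic_def
    by (intro exI[of _ "{Poly_Mapping.single 0 1}"] conjI) auto
  then have "openin zariski (UNIV :: ('n, 'k alg_closure) proj set)"
    by (simp add: openin_zariski)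
  then show ?thesis using openin_subset by blast
qed

lemma closedin_zariski: "closedin zariski Z \<longleftrightarrow> projective_algebraic Z"
  by (simp add: closedin_def openin_zariski Compl_eq_Diff_UNIV [symmetric])


section \<open>Varieties, rational points and endomorphisms\<close>

text \<open>Varieties are not required to be irreducible.\<close>

definition quasi_projective_variety :: "('n :: finite, 'k :: field alg_closure) proj set \<Rightarrow> bool" where
  "quasi_projective_variety V \<longleftrightarrow>
     (\<exists>U Z. openin zariski U \<and> closedin zariski Z \<and> V = U \<inter> Z)"

definition rational_points :: "('n, 'k :: field alg_closure) proj set \<Rightarrow> ('n, 'k alg_closure) proj set" where
  "rational_points V = {P \<in> V. \<exists>x\<in>hcoords P. \<forall>i. x i \<in> range to_ac}"

text \<open>
  A morphism over \<open>'k\<close> is given, locally in the Zariski topology over \<open>'k\<close>, by homogeneous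
  polynomials over \<open>'k\<close> of the same degree without a common zero; that they do not vanish
  simultaneously is implied by membership in \<^const>\<open>hcoords\<close>.
  Values of \<open>\<Phi>\<close> outside \<open>V\<close> are irrelevant.
\<close>

definition variety_endomorphism ::
    "('n :: finite, 'k :: field alg_closure) proj set \<Rightarrow>
     (('n, 'k alg_closure) proj \<Rightarrow> ('n, 'k alg_closure) proj) \<Rightarrow> bool" where
  "variety_endomorphism V \<Phi> \<longleftrightarrow>
     \<Phi> ` V \<subseteq> V \<and>
     (\<forall>P\<in>V. \<exists>U. openin (subtopology zariski V) U \<and> P \<in> U \<and>
        (\<exists>(F :: 'n \<Rightarrow> ('n, 'k) mpoly) d. (\<forall>i. homogeneous d (F i)) \<and>
           (\<forall>Q\<in>U. \<forall>x\<in>hcoords Q. (\<lambda>i. eval_ac (F i) x) \<in> hcoords (\<Phi> Q))))"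


section \<open>Irreducibility and dimension\<close>

definition irreducible_space :: "'a topology \<Rightarrow> bool" where
  "irreducible_space T \<longleftrightarrow> topspace T \<noteq> {} \<and>
     (\<forall>A B. closedin T A \<and> closedin T B \<and> topspace T = A \<union> B \<longrightarrow> A = topspace T \<or> B = topspace T)"

text \<open>
  The Krull dimension: the supremum of the lengths \<open>r\<close> of chains
  \<open>Z 0 \<subset> Z 1 \<subset> \<dots> \<subset> Z r\<close> of irreducible closed subsets. (It is 0 for the empty space.)
\<close>

definition krull_dim :: "'a topology \<Rightarrow> enat" where
  "krull_dim T = Sup {enat r | r. \<exists>Z :: nat \<Rightarrow> 'a set.
     (\<forall>i\<le>r. closedin T (Z i) \<and> irreducible_space (subtopology T (Z i))) \<and>
     (\<forall>i<r. Z i \<subset> Z (Suc i))}"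

text \<open>A curve in \<open>V\<close> is a closed subvariety of \<open>V\<close>.\<close>

definition irreducible_curve_in ::
    "('n :: finite, 'k :: field alg_closure) proj set \<Rightarrow> ('n, 'k alg_closure) proj set \<Rightarrow> bool" where
  "irreducible_curve_in V C \<longleftrightarrow>
     closedin (subtopology zariski V) C \<and>
     irreducible_space (subtopology zariski C) \<and>
     krull_dim (subtopology zariski C) = 1"


section \<open>Dynamics and density\<close>

definition preperiodic :: "('a \<Rightarrow> 'a) \<Rightarrow> 'a \<Rightarrow> bool" where
  "preperiodic \<Phi> \<alpha> \<longleftrightarrow> finite {(\<Phi> ^^ n) \<alpha> | n. True}"

text \<open>
  The upper limit is along the filter of finite intervals \<open>I\<close> whose cardinality tends to infinity.
\<close>

definition long_intervals :: "nat set filter" where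
  "long_intervals = inf (filtercomap card at_top) (principal {I. \<exists>a b. I = {a..<b}})"

definition banach_density :: "nat set \<Rightarrow> ereal" where
  "banach_density S = Limsup long_intervals (\<lambda>I. ereal (real (card (S \<inter> I)) / real (card I)))"

end

theory Submission
  imports Defs
begin

text \<open>
  If \<open>n\<close> and \<open>n + k\<close> lie in \<open>S\<close> for infinitely many \<open>n\<close>, then the closed subset \<open>C \<inter> \<Phi>\<^sup>-\<^sup>k(C)\<close>
  of \<open>C\<close> contains infinitely many rational points of the orbit. A proper closed subset of an
  irreducible curve has only finitely many rational points, because the topology is noetherian and
  rational points are closed; hence \<open>\<Phi>\<^sup>k(C) \<subseteq> C\<close>. Positive density makes some \<open>k \<ge> 1\<close> of
  this kind exist. For the least such \<open>k\<close>, any two elements of \<open>S\<close> are congruent modulo \<open>k\<close>, as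
  otherwise shifting both by multiples of \<open>k\<close> would produce infinitely many pairs with a smaller
  gap. So \<open>S\<close> is exactly a progression \<open>b + k\<nat>\<close>, of density \<open>1/k\<close>.
\<close>

section \<open>The Zariski topology is noetherian\<close>

text \<open>Coordinates are treated one at a time: each step passes to a subsequence that is
  nondecreasing in one more coordinate, and there are only finitely many.\<close>

lemma dickson:
  fixes m :: "nat \<Rightarrow> ('n :: finite \<Rightarrow> nat)"
  obtains i j where "i < j" "m i \<le> m j"
proof -
  have "\<exists>r :: nat \<Rightarrow> nat. strict_mono r \<and> (\<forall>x\<in>A. mono (\<lambda>n. m (r n) x))" if "finite A" for A
    using that
  proof (induction A)
    case empty
    show ?case by (intro exI[of _ id]) (auto simp: strict_mono_def)
  next
    case (insert a A)
    then obtain r :: "nat \<Rightarrow> nat" where r: "strict_mono r" "\<forall>x\<in>A. mono (\<lambda>n. m (r n) x)" by blast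
    define u where "u n = m (r n) a" for n
    have "\<exists>s :: nat \<Rightarrow> nat. strict_mono s \<and> mono (u \<circ> s)"
    proof -
      obtain s :: "nat \<Rightarrow> nat" where s: "strict_mono s" "monoseq (\<lambda>n. u (s n))"
        using seq_monosub[of u] by blast
      show ?thesis
      proof (cases "incseq (\<lambda>n. u (s n))")
        case True
        with s show ?thesis by (auto simp: o_def)
      next
        case False
        with s(2) have dec: "decseq (\<lambda>n. u (s n))" by (simp add: monoseq_iff)
        \<comment> \<open>\<open>N\<close> is a position where the nonincreasing sequence takes its
          least value; from there on it is constant, hence also nondecreasing.\<close>
        define N where "N = (ARG_MIN (\<lambda>n. u (s n)) n. True)"
        have N: "u (s N) \<le> u (s n)" for n
          unfolding N_def by (rule arg_min_nat_le) simp
        have eq: "u (s (N + n)) = u (s N)" for n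
          using N[of "N + n"] decseqD[OF dec, of N "N + n"] by simp
        have "strict_mono (\<lambda>n. s (N + n))"
          using s(1) by (auto simp: strict_mono_def)
        moreover have "mono (u \<circ> (\<lambda>n. s (N + n)))"
          by (simp add: mono_def eq)
        ultimately show ?thesis by blast
      qed
    qed
    then obtain s :: "nat \<Rightarrow> nat" where s: "strict_mono s" "mono (u \<circ> s)" by blast
    have "mono (\<lambda>n. m (r (s n)) x)" if "x \<in> A" for x
      using that r(2) strict_mono_mono[OF s(1)] by (auto simp: mono_def)
    with r(1) s show ?case
      by (intro exI[of _ "r \<circ> s"])
         (auto simp: strict_mono_def u_def o_def)
  qed
  from this[of UNIV] obtain r :: "nat \<Rightarrow> nat" where r: "strict_mono r" "\<And>x. mono (\<lambda>n. m (r n) x)"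
    by auto
  show thesis
  proof
    show "r 0 < r 1" using r(1) by (simp add: strict_mono_def)
    show "m (r 0) \<le> m (r 1)" using r(2) by (auto simp: mono_def le_fun_def)
  qed
qed

section \<open>The lexicographic order on monomials and leading monomials\<close>

definition lex_less :: "('n :: finite \<Rightarrow>\<^sub>0 nat) \<Rightarrow> ('n \<Rightarrow>\<^sub>0 nat) \<Rightarrow> bool" where
  "lex_less m m' \<longleftrightarrow> (\<exists>i. Poly_Mapping.lookup m i < Poly_Mapping.lookup m' i \<and>
     (\<forall>j. to_nat j < to_nat i \<longrightarrow> Poly_Mapping.lookup m j = Poly_Mapping.lookup m' j))"

lemma lex_less_trans: "lex_less a b \<Longrightarrow> lex_less b c \<Longrightarrow> lex_less a c"
proof -
  assume "lex_less a b" "lex_less b c"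
  then obtain i j where
    i: "Poly_Mapping.lookup a i < Poly_Mapping.lookup b i"
       "\<And>l. to_nat l < to_nat i \<Longrightarrow> Poly_Mapping.lookup a l = Poly_Mapping.lookup b l" and
    j: "Poly_Mapping.lookup b j < Poly_Mapping.lookup c j"
       "\<And>l. to_nat l < to_nat j \<Longrightarrow> Poly_Mapping.lookup b l = Poly_Mapping.lookup c l"
    unfolding lex_less_def by blast
  consider "to_nat i < to_nat j" | "i = j" | "to_nat j < to_nat i"
    using linorder_less_linear[of "to_nat i" "to_nat j"] inj_to_nat by (auto simp: inj_def)
  then show ?thesis
  proof cases
    case 1
    with i j show ?thesis unfolding lex_less_def by (intro exI[of _ i]) auto
  next
    case 2
    with i j show ?thesis unfolding lex_less_def by (intro exI[of _ i]) auto
  next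
    case 3
    with i j show ?thesis unfolding lex_less_def by (intro exI[of _ j]) auto
  qed
qed

lemma lex_less_linear: "lex_less a b \<or> a = b \<or> lex_less b a"
proof (cases "a = b")
  case False
  then have "\<exists>i. Poly_Mapping.lookup a i \<noteq> Poly_Mapping.lookup b i"
    by (auto intro: poly_mapping_eqI)
  then obtain i where i: "Poly_Mapping.lookup a i \<noteq> Poly_Mapping.lookup b i"
      "\<And>j. to_nat j < to_nat i \<Longrightarrow> Poly_Mapping.lookup a j = Poly_Mapping.lookup b j"
    using ex_has_least_nat[of "\<lambda>i. Poly_Mapping.lookup a i \<noteq> Poly_Mapping.lookup b i" _ to_nat]
    by (metis not_le)
  then show ?thesis unfolding lex_less_def by (metis nat_neq_iff)
qed simp

lemma lex_less_add: "lex_less a b \<Longrightarrow> lex_less (c + a) (c + b)"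
  by (auto simp: lex_less_def lookup_add)

text \<open>This links the order to Dickson's lemma: pointwise comparison of exponents is
  divisibility of monomials, which the lexicographic order respects.\<close>

lemma not_lex_less:
  assumes "Poly_Mapping.lookup a \<le> Poly_Mapping.lookup b"
  shows "\<not> lex_less b a"
  using assms by (auto simp: lex_less_def le_fun_def not_less)

text \<open>By Dickson's lemma an infinite descent would contain a monomial dividing a later, hence
  smaller, one.\<close>

lemma wf_lex_less: "wf {(a :: 'n :: finite \<Rightarrow>\<^sub>0 nat, b). lex_less a b}"
  unfolding wf_iff_no_infinite_down_chain
proof
  assume "\<exists>f. \<forall>i. (f (Suc i), f i :: 'n \<Rightarrow>\<^sub>0 nat) \<in> {(a, b). lex_less a b}"
  then obtain f :: "nat \<Rightarrow> ('n \<Rightarrow>\<^sub>0 nat)" where "\<forall>i. (f (Suc i), f i) \<in> {(a, b). lex_less a b}" by blast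
  then have f: "lex_less (f (Suc i)) (f i)" for i by simp
  have desc: "lex_less (f (i + Suc d)) (f i)" for i d
    by (induction d) (use f lex_less_trans in auto)
  obtain i j where "i < j" "Poly_Mapping.lookup (f i) \<le> Poly_Mapping.lookup (f j)"
    using dickson[of "\<lambda>i. Poly_Mapping.lookup (f i)"] by blast
  with desc[of i "j - Suc i"] not_lex_less show False by auto
qed

definition is_leading :: "('n :: finite \<Rightarrow>\<^sub>0 nat) \<Rightarrow> ('n, 'k :: zero) mpoly \<Rightarrow> bool" where
  "is_leading m f \<longleftrightarrow> m \<in> Poly_Mapping.keys f \<and> (\<forall>m'\<in>Poly_Mapping.keys f. m' = m \<or> lex_less m' m)"

lemma ex_leading:
  assumes "f \<noteq> 0"
  obtains m where "is_leading m f"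
proof -
  have "\<exists>m\<in>A. \<forall>m'\<in>A. m' = m \<or> lex_less m' m" if "finite A" "A \<noteq> {}" for A :: "('a \<Rightarrow>\<^sub>0 nat) set"
    using that
  proof (induction rule: finite_ne_induct)
    case (insert x F)
    then obtain m where m: "m \<in> F" "\<forall>m'\<in>F. m' = m \<or> lex_less m' m" by blast
    show ?case
    proof (cases "lex_less x m")
      case True
      with m show ?thesis by (intro bexI[of _ m]) auto
    next
      case False
      with lex_less_linear[of x m] m show ?thesis
        by (intro bexI[of _ x]) (auto intro: lex_less_trans)
    qed
  qed auto
  from this[of "Poly_Mapping.keys f"] assms that show thesis
    by (auto simp: is_leading_def)
qed

section \<open>Monomial multiples, vanishing ideals and the descending chain condition\<close>

lemma single_times_mpoly:
  "Poly_Mapping.single t c * f =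
     (\<Sum>m\<in>Poly_Mapping.keys f. Poly_Mapping.single (t + m) (c * Poly_Mapping.lookup f m))"
proof -
  have "Poly_Mapping.single t c * f =
      Poly_Mapping.single t c * (\<Sum>m\<in>Poly_Mapping.keys f. Poly_Mapping.single m (Poly_Mapping.lookup f m))"
    by (subst mpoly_sum_single[of f]) (rule refl)
  then show ?thesis by (simp add: sum_distrib_left mult_single)
qed

lemma lookup_single_times:
  fixes f :: "('n, 'k :: field) mpoly"
  shows "Poly_Mapping.lookup (Poly_Mapping.single t c * f) (t + m) = c * Poly_Mapping.lookup f m"
  by (simp add: single_times_mpoly lookup_sum lookup_single when_def in_keys_iff)

lemma keys_single_times:
  fixes f :: "('n, 'k :: field) mpoly"
  shows "Poly_Mapping.keys (Poly_Mapping.single t c * f) \<subseteq> (+) t ` Poly_Mapping.keys f"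
  using keys_mult[of "Poly_Mapping.single t c" f] by (auto split: if_splits)

lemma eval_ac_diff: "eval_ac (f - g) x = eval_ac f x - eval_ac g x"
  using eval_ac_add[of "f - g" g x] by (simp add: algebra_simps)

text \<open>The vanishing ideal of a set of points. Its members may be inhomogeneous, so leading
  terms can be cancelled without tracking degrees.\<close>

definition vanishing :: "('n :: finite, 'k :: field alg_closure) proj set \<Rightarrow> ('n, 'k) mpoly set" where
  "vanishing A = {f. \<forall>P\<in>A. \<forall>x\<in>hcoords P. eval_ac f x = 0}"

lemma vanishing_antimono: "A \<subseteq> B \<Longrightarrow> vanishing B \<subseteq> vanishing A"
  by (auto simp: vanishing_def)

text \<open>
  Hilbert's basis theorem without generators: along a strictly decreasing chain of closed sets,
  pick at each step a new element of the vanishing ideal with least possible leading monomial.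
  By Dickson's lemma one of these monomials divides a later one, which can then be cancelled.
\<close>

lemma wf_closedin_zariski:
  fixes V :: "('n :: finite, 'k :: field alg_closure) proj set"
  shows "wf {(A, B). A \<subset> B \<and> closedin (subtopology zariski V) A}"
  unfolding wf_iff_no_infinite_down_chain
proof
  assume "\<exists>f. \<forall>i. (f (Suc i), f i :: ('n, 'k alg_closure) proj set) \<in> {(A, B). A \<subset> B \<and> closedin (subtopology zariski V) A}"
  then obtain A :: "nat \<Rightarrow> ('n, 'k alg_closure) proj set" where
    "\<forall>i. (A (Suc i), A i) \<in> {(A, B). A \<subset> B \<and> closedin (subtopology zariski V) A}" by blast
  then have A: "A (Suc i) \<subset> A i" "closedin (subtopology zariski V) (A (Suc i))" for i
    by simp_all
  \<comment> \<open>The relation makes only the smaller set of each pair closed; \<open>A 0\<close>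
    may fail to be closed, so the chain is shifted by one.\<close>
  define B where "B i = A (Suc i)" for i
  have B: "B (Suc i) \<subset> B i" "closedin (subtopology zariski V) (B i)" for i
    using A by (auto simp: B_def)
  define N where "N i = vanishing (B (Suc i)) - vanishing (B i)" for i
  have decB: "B j \<subseteq> B i" if "i \<le> j" for i j
    by (rule lift_Suc_antimono_le[of B, OF psubset_imp_subset[OF B(1)] that])
  \<comment> \<open>At a point lost between \<open>B i\<close> and \<open>B (Suc i)\<close>, some
    equation defining \<open>B (Suc i)\<close> must fail.\<close>
  have "\<exists>f. f \<in> N i" for i
  proof -
    obtain P where P: "P \<in> B i" "P \<notin> B (Suc i)" using B(1) by blast
    obtain Z where Z: "closedin zariski Z" "B (Suc i) = Z \<inter> V"
      using B(2)[of "Suc i"] by (auto simp: closedin_subtopology)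
    then obtain F :: "('n, 'k) mpoly set" where F: "Z = zero_locus F"
      by (auto simp: closedin_zariski projective_algebraic_def)
    have "P \<in> V" using P(1) closedin_subset[OF B(2)[of i]] by auto
    with P Z have "P \<notin> zero_locus F" by (auto simp: F)
    then obtain f x where "f \<in> F" "x \<in> hcoords P" "eval_ac f x \<noteq> 0"
      by (auto simp: zero_locus_def)
    moreover from this have "f \<in> vanishing (B (Suc i))"
      by (auto simp: vanishing_def Z F zero_locus_def)
    ultimately show ?thesis using P(1) by (auto simp: N_def vanishing_def)
  qed
  moreover have "f \<noteq> 0" if "f \<in> N i" for f i
    using that by (auto simp: N_def vanishing_def)
  ultimately have ex: "\<exists>m f. f \<in> N i \<and> is_leading m f" for i
    by (metis ex_leading)
  have "\<exists>m f. f \<in> N i \<and> is_leading m f \<and> (\<forall>m' g. g \<in> N i \<and> is_leading m' g \<longrightarrow> \<not> lex_less m' m)" for i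
  proof -
    let ?M = "{m. \<exists>f\<in>N i. is_leading m f}"
    obtain m0 where "m0 \<in> ?M" using ex[of i] by blast
    with wf_lex_less obtain m where m: "m \<in> ?M" "\<And>m'. (m', m) \<in> {(a, b). lex_less a b} \<Longrightarrow> m' \<notin> ?M"
      by (rule wfE_min) blast
    then show ?thesis by blast
  qed
  then obtain m f where f: "\<And>i. f i \<in> N i" "\<And>i. is_leading (m i) (f i)"
    and least: "\<And>i m' g. g \<in> N i \<Longrightarrow> is_leading m' g \<Longrightarrow> \<not> lex_less m' (m i)"
    by metis
  obtain i j where ij: "i < j" "Poly_Mapping.lookup (m i) \<le> Poly_Mapping.lookup (m j)"
    using dickson[of "\<lambda>i. Poly_Mapping.lookup (m i)"] by blast
  define t where "t = m j - m i"
  have t: "m j = t + m i"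
    using ij(2) by (intro poly_mapping_eqI) (auto simp: t_def lookup_add lookup_minus le_fun_def)
  have nz: "Poly_Mapping.lookup (f i) (m i) \<noteq> 0"
    using f(2)[of i] by (auto simp: is_leading_def in_keys_iff)
  \<comment> \<open>\<open>g\<close> is the monomial multiple of \<open>f i\<close> with the same
    coefficient at \<open>m j\<close> as \<open>f j\<close>, so the difference \<open>h\<close> has
    no term there.\<close>
  define g where "g = Poly_Mapping.single t
    (Poly_Mapping.lookup (f j) (m j) / Poly_Mapping.lookup (f i) (m i)) * f i"
  define h where "h = f j - g"
  \<comment> \<open>Since \<open>i < j\<close>, the set \<open>B j\<close> lies in
    \<open>B (Suc i)\<close>, where \<open>f i\<close> vanishes. So \<open>g\<close> vanishes on
    \<open>B j\<close> and on \<open>B (Suc j)\<close>, and subtracting it from \<open>f j\<close>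
    does not leave \<open>N j\<close>.\<close>
  have "f i \<in> vanishing (B j)"
    using f(1)[of i] vanishing_antimono[OF decB[of "Suc i" j]] ij(1) by (auto simp: N_def)
  then have "g \<in> vanishing (B j)" by (auto simp: vanishing_def g_def eval_ac_mult)
  moreover from this have "g \<in> vanishing (B (Suc j))" using vanishing_antimono[OF decB[of j "Suc j"]] by auto
  ultimately have "h \<in> N j"
    using f(1)[of j] by (auto simp: N_def vanishing_def h_def eval_ac_diff)
  then have "h \<noteq> 0" by (auto simp: N_def vanishing_def)
  then obtain n where n: "is_leading n h" by (rule ex_leading)
  have "Poly_Mapping.lookup h (m j) = 0"
    using nz unfolding h_def g_def lookup_minus t lookup_single_times by (simp add: t)
  with n have "n \<noteq> m j" by (auto simp: is_leading_def in_keys_iff)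
  \<comment> \<open>All monomials of \<open>f j\<close> and of the shifted \<open>f i\<close> other
    than \<open>m j\<close> lie below \<open>m j\<close>, so \<open>h\<close> contradicts the
    minimal choice of \<open>m j\<close>.\<close>
  moreover have "n \<in> Poly_Mapping.keys (f j) \<union> (+) t ` Poly_Mapping.keys (f i)"
    using n keys_diff[of "f j" g] keys_single_times unfolding is_leading_def h_def g_def by blast
  ultimately have "lex_less n (m j)"
    using f(2)[of i] f(2)[of j] unfolding t is_leading_def by (auto intro: lex_less_add)
  with least[OF \<open>h \<in> N j\<close> n] show False by blast
qed

section \<open>Endomorphisms and rational points\<close>

lemma homogeneous_1: "homogeneous 0 (1 :: ('n :: finite, 'k :: field) mpoly)"
  by (simp add: homogeneous_def monom_degree_def)

lemma homogeneous_power: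
  fixes f :: "('n :: finite, 'k :: field) mpoly"
  shows "homogeneous d f \<Longrightarrow> homogeneous (n * d) (f ^ n)"
  by (induction n) (auto simp: homogeneous_1 intro: homogeneous_mult)

lemma homogeneous_prod:
  fixes f :: "'i \<Rightarrow> ('n :: finite, 'k :: field) mpoly"
  assumes "\<And>i. i \<in> I \<Longrightarrow> homogeneous (d i) (f i)"
  shows "homogeneous (\<Sum>i\<in>I. d i) (\<Prod>i\<in>I. f i)"
  using assms
  by (induction I rule: infinite_finite_induct) (auto simp: homogeneous_1 intro: homogeneous_mult)

lemma homogeneous_sum:
  assumes "\<And>i. i \<in> I \<Longrightarrow> homogeneous d (f i)"
  shows "homogeneous d (\<Sum>i\<in>I. f i)"
  using assms Poly_Mapping.keys_sum[of f I] unfolding homogeneous_def by blast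

lemma homogeneous_diff:
  fixes f :: "('n :: finite, 'k :: field) mpoly"
  assumes "homogeneous d f" "homogeneous d g"
  shows "homogeneous d (f - g)"
  using assms keys_diff[of f g] unfolding homogeneous_def by blast

lemma homogeneous_single: "homogeneous (monom_degree m) (Poly_Mapping.single m c)"
  by (auto simp: homogeneous_def)

lemma eval_ac_1: "eval_ac (1 :: ('n :: finite, 'k :: field) mpoly) x = 1"
  using eval_ac_single[of 0 1 x] by (simp add: monom_eval_def)

lemma eval_ac_power: "eval_ac (f ^ n) x = eval_ac f x ^ n"
  by (induction n) (auto simp: eval_ac_1 eval_ac_mult)

lemma eval_ac_prod: "eval_ac (\<Prod>i\<in>I. f i) x = (\<Prod>i\<in>I. eval_ac (f i) x)"
  by (induction I rule: infinite_finite_induct) (auto simp: eval_ac_1 eval_ac_mult)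

definition compose_mpoly ::
    "('n :: finite, 'k :: field) mpoly \<Rightarrow> ('n \<Rightarrow> ('n, 'k) mpoly) \<Rightarrow> ('n, 'k) mpoly" where
  "compose_mpoly g F = (\<Sum>m\<in>Poly_Mapping.keys g.
     Poly_Mapping.single 0 (Poly_Mapping.lookup g m) * (\<Prod>i\<in>UNIV. F i ^ Poly_Mapping.lookup m i))"

lemma eval_compose_mpoly: "eval_ac (compose_mpoly g F) x = eval_ac g (\<lambda>i. eval_ac (F i) x)"
  unfolding compose_mpoly_def eval_ac_sum eval_ac_mult eval_ac_single eval_ac_prod eval_ac_power
  by (subst (2) eval_ac_def) (simp add: monom_eval_def)

lemma homogeneous_compose_mpoly:
  fixes g :: "('n :: finite, 'k :: field) mpoly"
  assumes "homogeneous e g" "\<And>i. homogeneous d (F i)"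
  shows "homogeneous (e * d) (compose_mpoly g F)"
  unfolding compose_mpoly_def
proof (rule homogeneous_sum)
  fix m assume "m \<in> Poly_Mapping.keys g"
  with assms(1) have e: "e = (\<Sum>i\<in>UNIV. Poly_Mapping.lookup m i)"
    by (simp add: homogeneous_def monom_degree_def)
  have "homogeneous (monom_degree (0 :: 'n \<Rightarrow>\<^sub>0 nat) + (\<Sum>i\<in>UNIV. Poly_Mapping.lookup m i * d))
      (Poly_Mapping.single 0 (Poly_Mapping.lookup g m) * (\<Prod>i\<in>UNIV. F i ^ Poly_Mapping.lookup m i))"
    by (intro homogeneous_mult homogeneous_single homogeneous_prod homogeneous_power assms(2))
  then show "homogeneous (e * d)
      (Poly_Mapping.single 0 (Poly_Mapping.lookup g m) * (\<Prod>i\<in>UNIV. F i ^ Poly_Mapping.lookup m i))"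
    by (simp add: e sum_distrib_right monom_degree_def)
qed

text \<open>Coordinate vectors of one point differ by a scalar, which a homogeneous polynomial turns
  into a power factor; testing a single vector is therefore enough.\<close>

lemma in_zero_locus_iff:
  assumes "\<forall>f\<in>F. \<exists>d. homogeneous d f" "x \<in> hcoords P"
  shows "P \<in> zero_locus F \<longleftrightarrow> (\<forall>f\<in>F. eval_ac f x = 0)"
proof
  show "\<forall>f\<in>F. eval_ac f x = 0" if "P \<in> zero_locus F"
    using that assms(2) unfolding zero_locus_def by blast
next
  assume x: "\<forall>f\<in>F. eval_ac f x = 0"
  have "eval_ac f y = 0" if f: "f \<in> F" and y: "y \<in> hcoords P" for f y
  proof -
    obtain c where c: "y = (\<lambda>i. c * x i)"
      using y unfolding hcoords_eq[OF assms(2)] by blast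
    obtain d where "homogeneous d f" using assms(1) f by blast
    from eval_ac_scale[OF this] x f show ?thesis unfolding c by simp
  qed
  then show "P \<in> zero_locus F" unfolding zero_locus_def by blast
qed

lemma variety_endomorphismE:
  fixes V :: "('n :: finite, 'k :: field alg_closure) proj set"
  assumes "variety_endomorphism V \<Phi>" "P \<in> V"
  obtains U d and F :: "'n \<Rightarrow> ('n, 'k) mpoly"
  where "openin (subtopology zariski V) U" "P \<in> U" "\<forall>i. homogeneous d (F i)"
    "\<forall>Q\<in>U. \<forall>x\<in>hcoords Q. (\<lambda>i. eval_ac (F i) x) \<in> hcoords (\<Phi> Q)"
proof -
  from assms obtain U where U: "openin (subtopology zariski V) U \<and> P \<in> U \<and>
        (\<exists>(F :: 'n \<Rightarrow> ('n, 'k) mpoly) d. (\<forall>i. homogeneous d (F i)) \<and>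
           (\<forall>Q\<in>U. \<forall>x\<in>hcoords Q. (\<lambda>i. eval_ac (F i) x) \<in> hcoords (\<Phi> Q)))"
    unfolding variety_endomorphism_def by meson
  with that show thesis by (elim conjE exE)
qed

text \<open>Near each point \<open>\<Phi>\<close> is given by forms \<open>F\<close>; substituting
  them into the equations of a closed set gives homogeneous equations for its preimage
  there.\<close>

lemma continuous_map_endomorphism:
  fixes V :: "('n :: finite, 'k :: field alg_closure) proj set"
  assumes "variety_endomorphism V \<Phi>"
  shows "continuous_map (subtopology zariski V) (subtopology zariski V) \<Phi>"
proof -
  have "openin (subtopology zariski V) {Q \<in> V. \<Phi> Q \<in> W}" if W: "openin zariski W"
    for W :: "('n, 'k alg_closure) proj set"
  proof (subst openin_subopen, intro ballI)
    fix P assume P: "P \<in> {Q \<in> V. \<Phi> Q \<in> W}"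
    obtain G :: "('n, 'k) mpoly set" where G: "\<forall>g\<in>G. \<exists>d. homogeneous d g" "W = - zero_locus G"
      using W by (auto simp: openin_zariski projective_algebraic_def)
    have "P \<in> V" using P by simp
    then obtain U F d where U: "openin (subtopology zariski V) U" "P \<in> U"
      and F: "\<forall>i. homogeneous d (F i :: ('n, 'k) mpoly)"
      "\<forall>Q\<in>U. \<forall>x\<in>hcoords Q. (\<lambda>i. eval_ac (F i) x) \<in> hcoords (\<Phi> Q)"
      by (rule variety_endomorphismE[OF assms])
    define H where "H = (\<lambda>g. compose_mpoly g F) ` G"
    have H: "\<forall>h\<in>H. \<exists>d. homogeneous d h"
      using G(1) homogeneous_compose_mpoly[OF _ F(1)[rule_format]] by (fastforce simp: H_def)
    have mem: "Q \<in> zero_locus H \<longleftrightarrow> \<Phi> Q \<in> zero_locus G" if "Q \<in> U" for Q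
    proof -
      obtain x where x: "x \<in> hcoords Q" using hcoords_nonempty by blast
      show ?thesis
        using in_zero_locus_iff[OF H x] in_zero_locus_iff[OF G(1) F(2)[rule_format, OF that x]]
        by (simp add: H_def eval_compose_mpoly)
    qed
    have "openin zariski (- zero_locus H)"
      using H by (auto simp: openin_zariski projective_algebraic_def)
    then have "openin (subtopology zariski V) (U \<inter> - zero_locus H)"
      using U(1) by (auto simp: openin_subtopology)
    moreover have "U \<subseteq> V" using openin_subset[OF U(1)] by simp
    ultimately show "\<exists>T. openin (subtopology zariski V) T \<and> P \<in> T \<and> T \<subseteq> {Q \<in> V. \<Phi> Q \<in> W}"
      using P U(2) G(2) mem by (intro exI[of _ "U \<inter> - zero_locus H"]) auto
  qed
  then have "continuous_map (subtopology zariski V) zariski \<Phi>"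
    by (simp add: continuous_map_def)
  moreover have "\<Phi> ` V \<subseteq> V" using assms by (simp add: variety_endomorphism_def)
  ultimately show ?thesis
    by (auto simp: continuous_map_in_subtopology)
qed

lemma continuous_map_funpow: "continuous_map T T f \<Longrightarrow> continuous_map T T (f ^^ n)"
  by (induction n) (auto intro: continuous_map_compose)

section \<open>Rational points and proper closed subsets of a curve\<close>

definition rational :: "('n, 'k :: field alg_closure) proj \<Rightarrow> bool" where
  "rational P \<longleftrightarrow> (\<exists>x\<in>hcoords P. \<forall>i. x i \<in> range to_ac)"

lemma rational_points_iff: "P \<in> rational_points V \<longleftrightarrow> P \<in> V \<and> rational P"
  by (simp add: rational_points_def rational_def)

lemma range_to_ac_eval:
  assumes "\<forall>i. x i \<in> range to_ac"
  shows "eval_ac f x \<in> range to_ac"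
proof -
  from assms have "\<exists>a. \<forall>i. x i = to_ac (a i)" by (intro choice) blast
  then obtain a where a: "\<And>i. x i = to_ac (a i)" by blast
  have "eval_ac f x = to_ac (\<Sum>m\<in>Poly_Mapping.keys f. Poly_Mapping.lookup f m *
      (\<Prod>i\<in>UNIV. a i ^ Poly_Mapping.lookup m i))"
    by (simp add: eval_ac_def monom_eval_def a to_ac_sum to_ac_prod)
  then show ?thesis by blast
qed

lemma rational_endomorphism:
  assumes "variety_endomorphism V \<Phi>" "P \<in> V" "rational P"
  shows "rational (\<Phi> P)"
proof -
  obtain x where x: "x \<in> hcoords P" "\<forall>i. x i \<in> range to_ac"
    using assms(3) unfolding rational_def by blast
  obtain F where "(\<lambda>i. eval_ac (F i) x) \<in> hcoords (\<Phi> P)"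
    using variety_endomorphismE[OF assms(1,2)] x(1) by metis
  then show ?thesis
    unfolding rational_def by (rule bexI[rotated]) (intro allI range_to_ac_eval x(2))
qed

text \<open>The point is cut out by the 2 by 2 minors of its coordinate vector against the vector of
  variables; these are linear forms over \<open>'k\<close> because the coordinates come from
  \<open>'k\<close>.\<close>

lemma closedin_rational:
  assumes "rational P"
  shows "closedin zariski {P}"
proof -
  obtain x where x: "x \<in> hcoords P" "\<forall>i. x i \<in> range to_ac"
    using assms unfolding rational_def by blast
  then have "\<exists>a. \<forall>i. x i = to_ac (a i)" by (intro choice) blast
  then obtain a where a: "\<And>i. x i = to_ac (a i)" by blast
  define coord :: "'a \<Rightarrow> ('a, 'b) mpoly"
    where "coord i = Poly_Mapping.single (Poly_Mapping.single i 1) 1" for i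
  define minor where "minor i j = Poly_Mapping.single 0 (a i) * coord j - Poly_Mapping.single 0 (a j) * coord i" for i j
  have coord: "eval_ac (coord i) y = y i" for i y
  proof -
    have "monom_eval (Poly_Mapping.single i 1) y = (\<Prod>j\<in>UNIV. if j = i then y j else 1)"
      unfolding monom_eval_def by (rule prod.cong) (auto simp: lookup_single when_def)
    then show ?thesis by (simp add: coord_def eval_ac_single)
  qed
  have minor: "eval_ac (minor i j) y = x i * y j - x j * y i" for i j y
    using eval_ac_add[of "minor i j" "Poly_Mapping.single 0 (a j) * coord i" y]
    by (simp add: minor_def eval_ac_mult eval_ac_single coord a monom_eval_def algebra_simps)
  have "homogeneous 1 (minor i j)" for i j
  proof -
    have "homogeneous 1 (Poly_Mapping.single 0 c * coord i)" for c i
      using homogeneous_single[of "Poly_Mapping.single i 1" c]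
      by (simp add: coord_def mult_single monom_degree_def lookup_single when_def)
    then show ?thesis
      unfolding minor_def by (intro homogeneous_diff)
  qed
  then have hom: "\<forall>f\<in>{minor i j | i j. True}. \<exists>d. homogeneous d f" by blast
  have "zero_locus {minor i j | i j. True} = {P}"
  proof (intro equalityI subsetI)
    fix Q assume Q: "Q \<in> zero_locus {minor i j | i j. True}"
    obtain y where y: "y \<in> hcoords Q" using hcoords_nonempty by blast
    have eq: "x i * y j = x j * y i" for i j
    proof -
      have "eval_ac (minor i j) y = 0" using Q unfolding in_zero_locus_iff[OF hom y] by blast
      then show ?thesis by (simp add: minor)
    qed
    \<comment> \<open>Vanishing minors make \<open>y\<close> proportional to \<open>x\<close>; a
      nonzero coordinate of \<open>x\<close> supplies the factor \<open>c\<close>.\<close>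
    obtain i where i: "x i \<noteq> 0" using hcoords_nonzero[OF x(1)] by auto
    define c where "c = y i / x i"
    have yc: "y = (\<lambda>j. c * x j)" using eq[of i] i by (auto simp: c_def field_simps)
    with hcoords_nonzero[OF y] have "c \<noteq> 0" by auto
    with yc have "y \<in> hcoords P" by (auto simp: hcoords_eq[OF x(1)])
    then have "hcoords P = hcoords Q" using hcoords_eq[OF y] hcoords_eq[of y P] by simp
    then show "Q \<in> {P}" by (simp add: hcoords_inject)
  next
    fix Q assume "Q \<in> {P}"
    then show "Q \<in> zero_locus {minor i j | i j. True}"
      using in_zero_locus_iff[OF hom x(1)] minor by auto
  qed
  with hom show ?thesis
    unfolding closedin_zariski projective_algebraic_def
    by (intro exI[of _ "{minor i j | i j. True}"] conjI) simp_all
qed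

text \<open>Noetherian induction on \<open>A\<close>: a reducible set is a union of two smaller
  closed sets, and an irreducible one has at most one rational point for dimension reasons.\<close>

lemma finite_rational_closedin_curve:
  assumes "irreducible_space (subtopology zariski C)" "krull_dim (subtopology zariski C) = 1"
    and "closedin (subtopology zariski C) A" "A \<noteq> C"
  shows "finite {P \<in> A. rational P}"
  using assms(3,4)
proof (induction A rule: wf_induct_rule[OF wf_closedin_zariski[of C]])
  case (1 A)
  have sub: "A \<subseteq> C" using closedin_subset[OF 1(2)] by simp
  show ?case
  proof (cases "irreducible_space (subtopology zariski A)")
    case True
    have "{P \<in> A. rational P} \<subseteq> {P}" if P: "P \<in> A" "rational P" for P
    proof (rule ccontr)
      assume "\<not> {P \<in> A. rational P} \<subseteq> {P}"
      then have ne: "{P} \<subset> A" using P by blast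
      \<comment> \<open>The chain \<open>{P}\<close>, \<open>A\<close>, \<open>C\<close> of
        irreducible closed sets has length 2, which dimension 1 forbids.\<close>
      define Z where "Z i = (if i = 0 then {P} else if i = 1 then A else C)" for i :: nat
      have "closedin (subtopology zariski C) (Z i) \<and>
          irreducible_space (subtopology (subtopology zariski C) (Z i))" if "i \<le> 2" for i
      proof -
        have "closedin (subtopology zariski C) {P}"
          using closedin_rational[OF P(2)] P(1) sub by (auto simp: closedin_subtopology)
        moreover have "irreducible_space (subtopology zariski {P})"
          unfolding irreducible_space_def using closedin_subset by fastforce
        moreover have "closedin (subtopology zariski C) C"
          using closedin_topspace[of "subtopology zariski C"] by simp
        moreover have "subtopology (subtopology zariski C) (Z i) = subtopology zariski (Z i)"
          using P(1) sub by (auto simp: subtopology_subtopology Z_def Int_absorb1)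
        ultimately show ?thesis
          using True assms(1) 1(2) by (auto simp: Z_def)
      qed
      moreover have "Z i \<subset> Z (Suc i)" if "i < 2" for i
        using that ne sub 1(3) by (auto simp: Z_def)
      ultimately have "enat 2 \<le> krull_dim (subtopology zariski C)"
        unfolding krull_dim_def by (intro Sup_upper CollectI exI[of _ "2 :: nat"] conjI refl exI[of _ Z]) blast+
      with assms(2) show False by (simp add: one_enat_def)
    qed
    then show ?thesis
      by (cases "{P \<in> A. rational P} = {}") (auto intro: finite_subset)
  next
    case False
    \<comment> \<open>The empty set also fails to be irreducible, so it is split off before a
      decomposition is taken.\<close>
    show ?thesis
    proof (cases "A = {}")
      case nonempty: False
      with False obtain A1 A2 where A12: "closedin (subtopology zariski A) A1"
          "closedin (subtopology zariski A) A2" "A = A1 \<union> A2" "A1 \<noteq> A" "A2 \<noteq> A"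
        by (auto simp: irreducible_space_def)
      have trans: "closedin (subtopology zariski C) B" if "closedin (subtopology zariski A) B" for B
        using closedin_trans_full[of "subtopology zariski C" A B] that 1(2) sub
        by (simp add: subtopology_subtopology Int_absorb1)
      have "finite {P \<in> B. rational P}" if "B \<in> {A1, A2}" for B
      proof -
        have "B \<subset> A" "closedin (subtopology zariski C) B" using that A12 trans by auto
        with 1(1)[of B] sub show ?thesis by auto
      qed
      from this[of A1] this[of A2] have "finite ({P \<in> A1. rational P} \<union> {P \<in> A2. rational P})"
        by simp
      then show ?thesis by (rule rev_finite_subset) (use A12(3) in auto)
    qed simp
  qed
qed

section \<open>Banach density\<close>

lemma eventually_long_intervals:
  "eventually P long_intervals \<longleftrightarrow> (\<exists>N. \<forall>a b. N \<le> b - a \<longrightarrow> P {a..<b})"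
proof -
  have "eventually P long_intervals \<longleftrightarrow>
      (\<exists>N. \<forall>I. N \<le> card I \<longrightarrow> (\<exists>a b. I = {a..<b}) \<longrightarrow> P I)"
    by (simp add: long_intervals_def eventually_inf_principal eventually_filtercomap_at_top_linorder)
  also have "\<dots> \<longleftrightarrow> (\<exists>N. \<forall>a b. N \<le> b - a \<longrightarrow> P {a..<b})"
    by (metis card_atLeastLessThan)
  finally show ?thesis .
qed

text \<open>Cut the interval into blocks of length \<open>N\<close> starting at \<open>a\<close>: no
  block holds two elements of \<open>T\<close>. The \<open>+ 1\<close> allows for an incomplete last
  block.\<close>

lemma card_spaced:
  fixes T :: "nat set"
  assumes "N > 0" "\<And>n m. n \<in> T \<Longrightarrow> m \<in> T \<Longrightarrow> n < m \<Longrightarrow> n + N \<le> m"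
  shows "card (T \<inter> {a..<b}) \<le> (b - a) div N + 1"
proof -
  have "inj_on (\<lambda>n. (n - a) div N) (T \<inter> {a..<b})"
  proof (rule linorder_inj_onI)
    fix n m assume nm: "n < m" "n \<in> T \<inter> {a..<b}" "m \<in> T \<inter> {a..<b}"
    then have "n - a + N \<le> m - a" using assms(2)[of n m] by auto
    then have "(n - a + N) div N \<le> (m - a) div N" by (rule div_le_mono)
    with assms(1) show "(n - a) div N \<noteq> (m - a) div N" by simp
  qed auto
  moreover have "(\<lambda>n. (n - a) div N) ` (T \<inter> {a..<b}) \<subseteq> {..(b - a) div N}"
    by (auto intro!: div_le_mono)
  ultimately have "card (T \<inter> {a..<b}) \<le> card {..(b - a) div N}"
    by (rule card_inj_on_le) simp
  then show ?thesis by simp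
qed

text \<open>The elements below \<open>M\<close> and the rounding add at most \<open>M + 1\<close> to
  the count, which is a negligible share of a long interval.\<close>

lemma banach_density_spaced:
  assumes "N > 0" "\<And>n m. n \<in> S \<Longrightarrow> m \<in> S \<Longrightarrow> M \<le> n \<Longrightarrow> n < m \<Longrightarrow> n + N \<le> m"
  shows "banach_density S \<le> ereal (1 / real N)"
proof (rule ereal_le_epsilon2)
  fix e :: real assume e: "e > 0"
  have "eventually (\<lambda>I. ereal (real (card (S \<inter> I)) / real (card I)) \<le> ereal (1 / real N + e)) long_intervals"
    unfolding eventually_long_intervals
  proof (intro exI allI impI)
    \<comment> \<open>The ceiling makes \<open>e * L\<close> at least \<open>M + 1\<close>; the
      final \<open>+ 1\<close> makes \<open>L\<close> positive.\<close>
    fix a b :: nat assume ab: "nat \<lceil>(real M + 1) / e\<rceil> + 1 \<le> b - a"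
    define L where "L = real (b - a)"
    have L: "L > 0" "real M + 1 \<le> e * L"
    proof -
      show "L > 0" using ab by (simp add: L_def)
      have "(real M + 1) / e \<le> L" using ab unfolding L_def by linarith
      with e show "real M + 1 \<le> e * L" by (simp add: field_simps)
    qed
    have "card (S \<inter> {a..<b}) \<le> card ({..<M} \<union> ((S \<inter> {M..}) \<inter> {a..<b}))"
      by (rule card_mono) auto
    also have "\<dots> \<le> card {..<M} + card ((S \<inter> {M..}) \<inter> {a..<b})"
      by (rule card_Un_le)
    also have "\<dots> \<le> M + ((b - a) div N + 1)"
      using card_spaced[of N "S \<inter> {M..}" a b] assms by auto
    finally have "real (card (S \<inter> {a..<b})) \<le> real M + (real ((b - a) div N) + 1)" by linarith
    moreover have "real ((b - a) div N) \<le> L / real N"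
      unfolding L_def by (rule of_nat_div_le_of_nat)
    moreover have "real M + (L / real N + 1) \<le> (1 / real N + e) * L"
      using L(2) by (simp add: field_simps)
    ultimately have "real (card (S \<inter> {a..<b})) \<le> (1 / real N + e) * L" by linarith
    then have "real (card (S \<inter> {a..<b})) / L \<le> 1 / real N + e"
      using L(1) by (simp add: pos_divide_le_eq)
    then show "ereal (real (card (S \<inter> {a..<b})) / real (card {a..<b})) \<le> ereal (1 / real N + e)"
      by (simp add: L_def)
  qed
  then show "banach_density S \<le> ereal (1 / real N) + ereal e"
    unfolding banach_density_def by (simp add: Limsup_bounded)
qed

text \<open>Spacing by \<open>k\<close> bounds the density from above; intervals of length
  \<open>k * L\<close> starting at \<open>b\<close> contain at least \<open>L\<close> members, which
  bounds it from below.\<close>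

lemma banach_density_progression:
  assumes "k > 0"
  shows "banach_density {k * n + b | n. True} = ereal (1 / real k)"
proof (rule antisym)
  let ?S = "{k * n + b | n. True}"
  have "n + k \<le> m" if "n \<in> ?S" "m \<in> ?S" "n < m" for n m
  proof -
    from that obtain i j where ij: "n = k * i + b" "m = k * j + b" by auto
    with that(3) have "k * Suc i \<le> k * j" by (intro mult_left_mono) auto
    with ij show ?thesis by simp
  qed
  then show "banach_density ?S \<le> ereal (1 / real k)"
    using assms by (intro banach_density_spaced[where M = 0]) auto
  show "ereal (1 / real k) \<le> banach_density ?S"
  proof (rule ccontr)
    assume "\<not> ereal (1 / real k) \<le> banach_density ?S"
    then have "eventually (\<lambda>I. ereal (real (card (?S \<inter> I)) / real (card I)) < ereal (1 / real k)) long_intervals"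
      unfolding banach_density_def not_le by (rule Limsup_lessD)
    then obtain N where N: "\<And>a c. N \<le> c - a \<Longrightarrow> real (card (?S \<inter> {a..<c})) / real (c - a) < 1 / real k"
      by (auto simp: eventually_long_intervals)
    \<comment> \<open>This choice keeps \<open>L\<close> positive and makes the test interval, of
      length \<open>k * L\<close>, long enough for \<open>N\<close> to apply.\<close>
    define L where "L = Suc N"
    have "card ((\<lambda>n. k * n + b) ` {..<L}) = L"
      using assms by (subst card_image) (auto simp: inj_on_def)
    moreover have "card ((\<lambda>n. k * n + b) ` {..<L}) \<le> card (?S \<inter> {b..<b + k * L})"
      using assms by (intro card_mono) auto
    ultimately have ge: "L \<le> card (?S \<inter> {b..<b + k * L})" by simp
    have "L > 0" by (simp add: L_def)
    then have pos: "real (k * L) > 0" and eq: "1 / real k * real (k * L) = real L"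
      using assms by simp_all
    have "L \<le> k * L" using assms by simp
    then have "N \<le> b + k * L - b" unfolding L_def by linarith
    from N[OF this] have "real (card (?S \<inter> {b..<b + k * L})) / real (k * L) < 1 / real k" by simp
    then have "real (card (?S \<inter> {b..<b + k * L})) < real L"
      unfolding pos_divide_less_eq[OF pos] eq .
    with ge show False by linarith
  qed
qed

section \<open>Return times to a curve\<close>

text \<open>If the iterates at \<open>m < n\<close> agree, every index from \<open>n\<close> on can
  be lowered by \<open>n - m\<close>, so the orbit is confined to its first \<open>n\<close>
  terms.\<close>

lemma inj_funpow_if_not_preperiodic:
  assumes "\<not> preperiodic f a"
  shows "inj (\<lambda>n. (f ^^ n) a)"
proof (rule linorder_injI)
  fix m n :: nat assume mn: "m < n"
  show "(f ^^ m) a \<noteq> (f ^^ n) a"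
  proof
    assume eq: "(f ^^ m) a = (f ^^ n) a"
    have "(f ^^ i) a \<in> (\<lambda>i. (f ^^ i) a) ` {..<n}" for i
    proof (induction i rule: less_induct)
      case (less i)
      show ?case
      proof (cases "i < n")
        case False
        then obtain d where d: "i = d + n" by (metis le_add_diff_inverse2 not_less)
        have "(f ^^ i) a = (f ^^ (d + m)) a" by (simp add: d funpow_add eq)
        with less[of "d + m"] mn d show ?thesis by simp
      qed auto
    qed
    then have "{(f ^^ n) a | n. True} \<subseteq> (\<lambda>i. (f ^^ i) a) ` {..<n}" by auto
    with assms show False by (auto simp: preperiodic_def dest: finite_subset)
  qed
qed

theorem theorem4p1:
  fixes V C :: "('n :: finite, 'k :: field alg_closure) proj set"
    and \<Phi> :: "('n, 'k alg_closure) proj \<Rightarrow> ('n, 'k alg_closure) proj"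
    and \<alpha> :: "('n, 'k alg_closure) proj"
    and S :: "nat set" and \<delta> :: real
  assumes "quasi_projective_variety V"
    and "variety_endomorphism V \<Phi>"
    and "irreducible_curve_in V C"
    and "\<alpha> \<in> rational_points V"
    and "\<not> preperiodic \<Phi> \<alpha>"
    and "S = {n. (\<Phi> ^^ n) \<alpha> \<in> rational_points C}"
    and "banach_density S = ereal \<delta>"
    and "\<delta> > 0"
  shows "\<exists>k :: nat. k \<ge> 1 \<and> real k = 1 / \<delta> \<and>
           (\<exists>b. {k * n + b | n. True} \<subseteq> S) \<and>
           (\<Phi> ^^ k) ` C \<subseteq> C"
proof -
  note endo = assms(2) and curve = assms(3)[unfolded irreducible_curve_in_def]
  have orbit: "(\<Phi> ^^ n) \<alpha> \<in> V \<and> rational ((\<Phi> ^^ n) \<alpha>)" for n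
  proof (induction n)
    case 0
    show ?case using assms(4) by (simp add: rational_points_iff)
  next
    case (Suc n)
    have "\<Phi> ` V \<subseteq> V" using endo by (simp add: variety_endomorphism_def)
    with Suc rational_endomorphism[OF endo] show ?case by auto
  qed
  have S: "n \<in> S \<longleftrightarrow> (\<Phi> ^^ n) \<alpha> \<in> C" for n
    using orbit[of n] by (simp add: assms(6) rational_points_iff)
  have "C \<subseteq> V" using curve closedin_subset[of "subtopology zariski V" C] by simp
  \<comment> \<open>\<open>D\<close> collects the positive shifts that map the whole curve into
    itself.\<close>
  define D where "D = {k. k > 0 \<and> (\<Phi> ^^ k) ` C \<subseteq> C}"
  have step: "n + k \<in> S" if "k \<in> D" "n \<in> S" for n k
    using that by (auto simp: D_def S add.commute[of n] funpow_add)
  \<comment> \<open>For \<open>k\<close> outside \<open>D\<close> the set \<open>?A\<close> is a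
    proper closed subset of \<open>C\<close>, with finitely many rational points; the orbit has no
    repetitions, so each accounts for at most one \<open>n\<close>.\<close>
  have finite_gap: "finite {n \<in> S. n + k \<in> S}" if k: "k > 0" "k \<notin> D" for k
  proof -
    let ?A = "{P \<in> V. (\<Phi> ^^ k) P \<in> C} \<inter> C"
    have "closedin (subtopology zariski V) {P \<in> V. (\<Phi> ^^ k) P \<in> C}"
      using closedin_continuous_map_preimage
        [OF continuous_map_funpow[OF continuous_map_endomorphism[OF endo]], of C k] curve by simp
    then have "closedin (subtopology (subtopology zariski V) C) ?A"
      by (auto simp: closedin_subtopology)
    then have "closedin (subtopology zariski C) ?A"
      using \<open>C \<subseteq> V\<close> by (simp add: subtopology_subtopology Int_absorb1)
    moreover have "?A \<noteq> C" using k by (auto simp: D_def)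
    ultimately have "finite {P \<in> ?A. rational P}"
      using curve by (intro finite_rational_closedin_curve) auto
    moreover have "(\<lambda>n. (\<Phi> ^^ n) \<alpha>) ` {n \<in> S. n + k \<in> S} \<subseteq> {P \<in> ?A. rational P}"
      using orbit by (auto simp: S add.commute[of _ k] funpow_add)
    ultimately show ?thesis
      using inj_funpow_if_not_preperiodic[OF assms(5)]
      by (meson finite_imageD finite_subset inj_on_subset subset_UNIV)
  qed
  \<comment> \<open>If the gaps of \<open>S\<close> eventually exceeded every bound, the density
    would be at most \<open>1 / real (Suc N)\<close> for every \<open>N\<close>.\<close>
  have not_sparse: False
    if sparse: "\<And>N. \<exists>M. \<forall>n\<in>S. \<forall>m\<in>S. M \<le> n \<longrightarrow> n < m \<longrightarrow> n + Suc N \<le> m"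
  proof -
    obtain N where N: "1 / real (Suc N) < \<delta>"
      using reals_Archimedean[OF assms(8)] by (auto simp: inverse_eq_divide)
    obtain M where "\<forall>n\<in>S. \<forall>m\<in>S. M \<le> n \<longrightarrow> n < m \<longrightarrow> n + Suc N \<le> m"
      using sparse[of N] by (rule exE)
    then have "banach_density S \<le> ereal (1 / real (Suc N))"
      by (intro banach_density_spaced[where M = M]) auto
    with assms(7) N show False by simp
  qed
  \<comment> \<open>The empty set is vacuously sparse.\<close>
  have "S \<noteq> {}" using not_sparse by auto
  have "D \<noteq> {}"
  proof
    assume "D = {}"
    \<comment> \<open>With \<open>D\<close> empty, each of the gaps from 1 to \<open>N\<close>
      occurs only finitely often; \<open>M\<close> is chosen beyond all these occurrences.\<close>
    have "\<exists>M. \<forall>n\<in>S. \<forall>m\<in>S. M \<le> n \<longrightarrow> n < m \<longrightarrow> n + Suc N \<le> m" for N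
    proof -
      have "finite (\<Union>k\<in>{1..N}. {n \<in> S. n + k \<in> S})"
        using finite_gap \<open>D = {}\<close> by auto
      then obtain M where M: "\<forall>n\<in>(\<Union>k\<in>{1..N}. {n \<in> S. n + k \<in> S}). n < M"
        unfolding finite_nat_set_iff_bounded by (rule exE)
      have "n + Suc N \<le> m" if "n \<in> S" "m \<in> S" "M \<le> n" "n < m" for n m
      proof (rule ccontr)
        assume "\<not> n + Suc N \<le> m"
        with that have "m - n \<in> {1..N}" "n + (m - n) \<in> S" by auto
        with that(1) have "n \<in> (\<Union>k\<in>{1..N}. {n \<in> S. n + k \<in> S})" by blast
        with M have "n < M" by (rule bspec)
        with that(3) show False by simp
      qed
      then show ?thesis by blast
    qed
    then show False by (rule not_sparse)
  qed
  define k where "k = (LEAST k. k \<in> D)"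
  have k: "k \<in> D" "k > 0" "\<And>j. j \<in> D \<Longrightarrow> k \<le> j"
    using \<open>D \<noteq> {}\<close> LeastI_ex[of "\<lambda>k. k \<in> D"] Least_le[of "\<lambda>k. k \<in> D"] by (auto simp: k_def D_def)
  have steps: "k * i + n \<in> S" if "n \<in> S" for i n
  proof (induction i)
    case (Suc i)
    from step[OF k(1) this] show ?case by (simp add: add_ac)
  qed (simp add: that)
  define b where "b = (LEAST b. b \<in> S)"
  have b: "b \<in> S" "\<And>n. n \<in> S \<Longrightarrow> b \<le> n"
    using \<open>S \<noteq> {}\<close> LeastI_ex[of "\<lambda>b. b \<in> S"] Least_le[of "\<lambda>b. b \<in> S"] by (auto simp: b_def)
  have "S = {k * n + b | n. True}"
  proof (intro equalityI subsetI)
    fix n assume n: "n \<in> S"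
    define j where "j = (n - b) mod k"
    define q where "q = (n - b) div k"
    have nb: "n = k * q + b + j" using b(2)[OF n] by (simp add: j_def q_def)
    \<comment> \<open>Moving \<open>k * q + b\<close> and \<open>n\<close> by multiples of
      \<open>k\<close> gives infinitely many pairs in \<open>S\<close> at distance \<open>j\<close>.
      A \<open>j\<close> with \<open>0 < j < k\<close> is outside \<open>D\<close> by minimality of
      \<open>k\<close>, so \<open>finite_gap\<close> excludes it.\<close>
    have "j = 0"
    proof (rule ccontr)
      assume "j \<noteq> 0"
      moreover have "j < k" using k(2) by (simp add: j_def)
      ultimately have "finite {n \<in> S. n + j \<in> S}"
        using finite_gap[of j] k(3)[of j] by auto
      moreover have "(\<lambda>i. k * (q + i) + b) ` UNIV \<subseteq> {n \<in> S. n + j \<in> S}"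
      proof (intro image_subsetI CollectI conjI)
        fix i
        show "k * (q + i) + b \<in> S" by (rule steps[OF b(1)])
        show "k * (q + i) + b + j \<in> S" using steps[OF n, of i] by (simp add: nb algebra_simps)
      qed
      ultimately have "finite (range (\<lambda>i. k * (q + i) + b))" by (rule finite_subset[rotated])
      moreover have "inj (\<lambda>i. k * (q + i) + b)" using k(2) by (auto simp: inj_def)
      ultimately show False using finite_imageD by blast
    qed
    with nb show "n \<in> {k * n + b | n. True}" by auto
  next
    fix n assume "n \<in> {k * n + b | n. True}"
    then show "n \<in> S" using steps[OF b(1)] by auto
  qed
  \<comment> \<open>Since \<open>S\<close> is exactly a progression, its density is known, and
    comparing it with \<open>\<delta>\<close> identifies \<open>k\<close>.\<close>
  moreover from this have "\<delta> = 1 / real k"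
    using banach_density_progression[OF k(2), of b] assms(7) by simp
  ultimately show ?thesis
    using k by (intro exI[of _ k]) (auto simp: D_def)
qed

end
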